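(* For all fixed positive integers $n>m$, there are algorithms which, given a finite graph $H$ (respectively a finite bipartite graph $H$), decide in time polynomial in $|H|$ whether $H$ is $(n,m)$-Helly (respectively whether $H$ is bipartite $(n,m)$-Helly).
   Context: Graphs are nonempty, connected and simple, endowed with the path metric, and presented by their adjacency matrix; $|H|$ is the number of vertices. A graph $H$ is $(n,m)$-Helly if for every collection of $n$ (not necessarily distinct) closed balls $B_1,\dots,B_n$ in $H$ of radius $\ge 1$: whenever every subcollection of $m$ of them has nonempty intersection, then $\bigcap_{i=1}^n B_i\neq\varnothing$. A bipartite graph $H$ is bipartite $(n,m)$-Helly if for all (not necessarily distinct) balls $B_1,\dots,B_n$ in $H$ (closed balls of non-negative integer radius) and each partite class $H_1$ of $H$: if any $m$ of the sets $B_1\cap H_1,\dots,B_n\cap H_1$ have nonempty intersection, then $\bigcap_{i=1}^n (B_i\cap H_1)\neq\varnothing$. *)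

theory Defs
  imports
    "Graph_Theory.Graph_Theory"
    "HOL-Computational_Algebra.Polynomial"
begin

section \<open>Helly properties of graphs\<close>

text \<open>A finite simple graph is a loop-free symmetric digraph on a finite vertex set
  (\<^locale>\<open>pair_graph\<close>): the edge between u and v is the pair of arcs (u,v), (v,u).
  Since \<^const>\<open>connected\<close> entails that there is a vertex, the following are the nonempty finite
  connected simple graphs.\<close>

definition fin_conn_graph :: "'a pair_pre_digraph \<Rightarrow> bool" where
  "fin_conn_graph G \<longleftrightarrow> pair_graph G \<and> connected (with_proj G)"

text \<open>The path metric is the cost of a shortest walk when every arc has weight 1. It takes integer
  values on a connected graph, so only integer radii are considered.\<close>

definition path_dist :: "'a pair_pre_digraph \<Rightarrow> 'a \<Rightarrow> 'a \<Rightarrow> ereal" where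
  "path_dist G u v = wf_digraph.\<mu> (with_proj G) (\<lambda>_. 1) u v"

definition closed_ball :: "'a pair_pre_digraph \<Rightarrow> 'a \<Rightarrow> nat \<Rightarrow> 'a set" where
  "closed_ball G v r = {u \<in> pverts G. path_dist G v u \<le> ereal (real r)}"

definition helly :: "nat \<Rightarrow> nat \<Rightarrow> 'a pair_pre_digraph \<Rightarrow> bool" where
  "helly n m G \<longleftrightarrow>
     (\<forall>(c :: nat \<Rightarrow> 'a) (r :: nat \<Rightarrow> nat).
        (\<forall>i<n. c i \<in> pverts G \<and> 1 \<le> r i) \<longrightarrow>
        (\<forall>S\<subseteq>{..<n}. card S = m \<longrightarrow> (\<Inter>i\<in>S. closed_ball G (c i) (r i)) \<noteq> {}) \<longrightarrow>
        (\<Inter>i<n. closed_ball G (c i) (r i)) \<noteq> {})"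

definition bipartition :: "'a pair_pre_digraph \<Rightarrow> 'a set \<Rightarrow> 'a set \<Rightarrow> bool" where
  "bipartition G X Y \<longleftrightarrow>
     X \<union> Y = pverts G \<and> X \<inter> Y = {} \<and> parcs G \<subseteq> X \<times> Y \<union> Y \<times> X"

definition bipartite :: "'a pair_pre_digraph \<Rightarrow> bool" where
  "bipartite G \<longleftrightarrow> (\<exists>X Y. bipartition G X Y)"

definition partite_class :: "'a pair_pre_digraph \<Rightarrow> 'a set \<Rightarrow> bool" where
  "partite_class G X \<longleftrightarrow> (\<exists>Y. bipartition G X Y)"

definition bipartite_helly :: "nat \<Rightarrow> nat \<Rightarrow> 'a pair_pre_digraph \<Rightarrow> bool" where
  "bipartite_helly n m G \<longleftrightarrow>
     (\<forall>(c :: nat \<Rightarrow> 'a) (r :: nat \<Rightarrow> nat) X.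
        (\<forall>i<n. c i \<in> pverts G) \<longrightarrow> partite_class G X \<longrightarrow>
        (\<forall>S\<subseteq>{..<n}. card S = m \<longrightarrow> (\<Inter>i\<in>S. closed_ball G (c i) (r i) \<inter> X) \<noteq> {}) \<longrightarrow>
        (\<Inter>i<n. closed_ball G (c i) (r i) \<inter> X) \<noteq> {})"


section \<open>Random access machines\<close>

text \<open>Algorithms are programs of the random access machine of Cook and Reckhow: finite lists of
  instructions acting on registers and on an indirectly addressed memory, both holding natural
  numbers. Every executed instruction costs one unit of time. The only arithmetic is addition and
  truncated subtraction, so after t steps all numbers have at most t + O(log s) bits, where s is
  the largest number among the program constants, jump targets and the input; hence polynomial
  time on this machine agrees with polynomial time on a Turing machine.\<close>

datatype instr =
    Const nat nat      \<comment> \<open>\<open>Const d k\<close>: register d becomes k\<close>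
  | Add nat nat nat    \<comment> \<open>\<open>Add d a b\<close>: register d becomes the sum of registers a and b\<close>
  | Sub nat nat nat    \<comment> \<open>\<open>Sub d a b\<close>: likewise with truncated subtraction\<close>
  | Load nat nat       \<comment> \<open>\<open>Load d a\<close>: register d becomes the memory cell addressed by register a\<close>
  | Store nat nat      \<comment> \<open>\<open>Store a s\<close>: the memory cell addressed by register a becomes register s\<close>
  | Jzero nat nat      \<comment> \<open>\<open>Jzero a l\<close>: jump to instruction l if register a is zero\<close>

record config =
  pc  :: nat
  reg :: "nat \<Rightarrow> nat"
  mem :: "nat \<Rightarrow> nat"

fun exec :: "instr \<Rightarrow> config \<Rightarrow> config" where
  "exec (Const d k) s = s\<lparr>pc := pc s + 1, reg := (reg s)(d := k)\<rparr>"
| "exec (Add d a b) s = s\<lparr>pc := pc s + 1, reg := (reg s)(d := reg s a + reg s b)\<rparr>"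
| "exec (Sub d a b) s = s\<lparr>pc := pc s + 1, reg := (reg s)(d := reg s a - reg s b)\<rparr>"
| "exec (Load d a) s = s\<lparr>pc := pc s + 1, reg := (reg s)(d := mem s (reg s a))\<rparr>"
| "exec (Store a b) s = s\<lparr>pc := pc s + 1, mem := (mem s)(reg s a := reg s b)\<rparr>"
| "exec (Jzero a l) s = s\<lparr>pc := (if reg s a = 0 then l else pc s + 1)\<rparr>"

text \<open>The machine halts as soon as the program counter leaves the program.\<close>

definition halted :: "instr list \<Rightarrow> config \<Rightarrow> bool" where
  "halted P s \<longleftrightarrow> length P \<le> pc s"

definition step :: "instr list \<Rightarrow> config \<Rightarrow> config" where
  "step P s = (if halted P s then s else exec (P ! pc s) s)"


section \<open>Deciding graph properties in polynomial time\<close>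

text \<open>A graph presented by its N by N adjacency matrix has vertex set \<open>{..<N}\<close>. The input consists
  of N in cell 0, followed by the entries of the matrix, row by row.\<close>

definition matrix_input :: "nat pair_pre_digraph \<Rightarrow> nat \<Rightarrow> nat" where
  "matrix_input G a =
     (let N = card (pverts G) in
      if a = 0 then N
      else if a \<le> N * N then of_bool (((a - 1) div N, (a - 1) mod N) \<in> parcs G)
      else 0)"

definition initial :: "nat pair_pre_digraph \<Rightarrow> config" where
  "initial G = \<lparr>pc = 0, reg = (\<lambda>_. 0), mem = matrix_input G\<rparr>"

text \<open>The class \<open>C\<close> is a promise on the input: nothing is required of the program on other inputs.
  The answer is read off register 0 (1 for yes, 0 for no).\<close>

definition decides_in_poly_time ::
  "instr list \<Rightarrow> (nat pair_pre_digraph \<Rightarrow> bool) \<Rightarrow> (nat pair_pre_digraph \<Rightarrow> bool) \<Rightarrow> bool" where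
  "decides_in_poly_time P C Q \<longleftrightarrow>
     (\<exists>p :: nat poly. \<forall>G. C G \<and> pverts G = {..<card (pverts G)} \<longrightarrow>
        (\<exists>t \<le> poly p (card (pverts G)).
           let s = (step P ^^ t) (initial G)
           in halted P s \<and> reg s 0 = of_bool (Q G)))"

end

theory Submission
  imports Defs
begin

text \<open>The machine tabulates all distances and then evaluates the definition of the Helly property
  by brute force: radii may be truncated at N because all distances are less than N, so there are
  only \<open>(N * N) ^ n\<close> families of balls to test, a polynomial number as n is fixed. The partite classes
  of a connected bipartite graph are the vertices at even and at odd distance from vertex 0.

  The tests are bounded sums and quantifiers over \<open>{..<N}\<close>. They compile to nested loops without
  data-dependent branching, each of exactly N iterations, so the running time is a polynomial in N that can be read
  off the program, and only the values computed need verification.\<close>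

section \<open>Bounded loops on the random access machine\<close>

text \<open>The program may depend on n and m, so the subsets of \<open>{..<n}\<close> of size m are
  listed when it is built. The generated code branches only to control loops, so truth values are
  numbers: nonzero means true, and a bounded sum then serves as existential quantifier, as a means
  of counting and, since the machine cannot multiply, as multiplication by N in address
  computations. The table comes from the Bellman-Ford recursion: distance at most k + 1 means
  distance at most k or an arc from a vertex at distance at most k. There is one layer for each
  threshold k < N, and a distance is read back as the number of thresholds it exceeds.\<close>

datatype loop_prog =
    Prim instr
  | Seq loop_prog loop_prog
  | Loop nat loop_prog

text \<open>Registers 0, 1 and 2 are reserved for the constants 0, N and 1. A loop counts its register
  down from N - 1 to 0.\<close>

definition consts_ok :: "nat \<Rightarrow> (nat \<Rightarrow> nat) \<Rightarrow> bool" where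
  "consts_ok N r \<longleftrightarrow> r 0 = 0 \<and> r 1 = N \<and> r 2 = 1"

type_synonym store = "(nat \<Rightarrow> nat) \<times> (nat \<Rightarrow> nat)"

definition config_of :: "nat \<Rightarrow> store \<Rightarrow> config" where
  "config_of p s = \<lparr>pc = p, reg = fst s, mem = snd s\<rparr>"

definition set_reg :: "nat \<Rightarrow> nat \<Rightarrow> store \<Rightarrow> store" where
  "set_reg i k s = ((fst s)(i := k), snd s)"

text \<open>Jumps are excluded below, so the program counter of \<open>Prim\<close> is arbitrary.
  Setting register \<open>i\<close> to N before the first iteration mirrors the machine, so that
  \<open>sem\<close> agrees with the code on every register, even if N is 0.\<close>

primrec sem :: "nat \<Rightarrow> loop_prog \<Rightarrow> store \<Rightarrow> store" where
  "sem N (Prim i) s = (let s' = exec i (config_of 0 s) in (reg s', mem s'))"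
| "sem N (Seq c d) s = sem N d (sem N c s)"
| "sem N (Loop i c) s = fold (\<lambda>k s. sem N c (set_reg i k s)) (rev [0..<N]) (set_reg i N s)"

fun writes_above :: "nat \<Rightarrow> instr \<Rightarrow> bool" where
  "writes_above b (Const d k) \<longleftrightarrow> b \<le> d"
| "writes_above b (Add d x y) \<longleftrightarrow> b \<le> d"
| "writes_above b (Sub d x y) \<longleftrightarrow> b \<le> d"
| "writes_above b (Load d x) \<longleftrightarrow> b \<le> d"
| "writes_above b (Store x y) \<longleftrightarrow> True"
| "writes_above b (Jzero x l) \<longleftrightarrow> False"

text \<open>The body of a loop may write only registers above the counter, so it cannot disturb the
  iteration.\<close>

primrec safe :: "nat \<Rightarrow> loop_prog \<Rightarrow> bool" where
  "safe b (Prim i) \<longleftrightarrow> writes_above b i"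
| "safe b (Seq c d) \<longleftrightarrow> safe b c \<and> safe b d"
| "safe b (Loop i c) \<longleftrightarrow> b \<le> i \<and> safe (Suc i) c"

primrec code_length :: "loop_prog \<Rightarrow> nat" where
  "code_length (Prim i) = 1"
| "code_length (Seq c d) = code_length c + code_length d"
| "code_length (Loop i c) = code_length c + 4"

text \<open>Jump targets are absolute, hence the address \<open>p\<close> of the code. The last
  instruction of a loop always jumps back, because register 0 is zero.\<close>

primrec code :: "nat \<Rightarrow> loop_prog \<Rightarrow> instr list" where
  "code p (Prim i) = [i]"
| "code p (Seq c d) = code p c @ code (p + code_length c) d"
| "code p (Loop i c) =
     [Add i 1 0, Jzero i (p + code_length c + 4), Sub i i 2] @ code (p + 3) c @ [Jzero 0 (p + 1)]"

text \<open>\<open>[:0, 1:]\<close> is the indeterminate N. A loop costs 2 for the initial copy of N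
  and the final test, and 3 per iteration for test, decrement and jump back.\<close>

primrec run_time :: "loop_prog \<Rightarrow> nat poly" where
  "run_time (Prim i) = 1"
| "run_time (Seq c d) = run_time c + run_time d"
| "run_time (Loop i c) = [:2:] + [:0, 1:] * (run_time c + [:3:])"

lemma length_code [simp]: "length (code p c) = code_length c"
  by (induction c arbitrary: p) auto

lemma fst_set_reg [simp]: "fst (set_reg i k s) = (fst s)(i := k)"
  and snd_set_reg [simp]: "snd (set_reg i k s) = snd s"
  by (simp_all add: set_reg_def)

text \<open>Replaces bookkeeping of live registers: whatever a computation must preserve is placed
  below its bound \<open>b\<close>.\<close>

lemma sem_frame: "safe b c \<Longrightarrow> x < b \<Longrightarrow> fst (sem N c s) x = fst s x"
proof (induction c arbitrary: b s)
  case (Prim i)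
  then show ?case by (cases i) (auto simp: config_of_def)
next
  case (Loop i c)
  have body: "fst (sem N c (set_reg i k s)) x = fst s x" for k s
    using Loop.IH[of "Suc i" "set_reg i k s"] Loop.prems by simp
  have "fst (fold (\<lambda>k s. sem N c (set_reg i k s)) ks s) x = fst s x" for ks s
    by (induction ks arbitrary: s) (simp_all add: body del: split_paired_All)
  with Loop.prems show ?case by simp
next
  case (Seq c d)
  then show ?case using Seq.IH(1)[of b] Seq.IH(2)[of b] by simp
qed

lemma consts_ok_sem:
  assumes "safe b c" "3 \<le> b" "consts_ok N (fst s)"
  shows "consts_ok N (fst (sem N c s))"
  using assms sem_frame[OF assms(1)] by (auto simp: consts_ok_def)

section \<open>Correctness and exact running time of the generated code\<close>

definition located :: "instr list \<Rightarrow> nat \<Rightarrow> instr list \<Rightarrow> bool" where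
  "located P p Q \<longleftrightarrow> (\<exists>pre post. P = pre @ Q @ post \<and> length pre = p)"

lemma located_append:
  assumes "located P p (Q @ Q')"
  shows "located P p Q" "located P (p + length Q) Q'"
proof -
  obtain pre post where *: "P = pre @ (Q @ Q') @ post" "length pre = p"
    using assms by (auto simp: located_def)
  then show "located P p Q" by (auto simp: located_def)
  from * have "P = (pre @ Q) @ Q' @ post" "length (pre @ Q) = p + length Q" by auto
  then show "located P (p + length Q) Q'" unfolding located_def by blast
qed

lemma located_Cons:
  assumes "located P p (i # Q)"
  shows "p < length P" "P ! p = i" "located P (Suc p) Q"
proof -
  show "p < length P" "P ! p = i" using assms by (auto simp: located_def)
  show "located P (Suc p) Q" using located_append(2)[of P p "[i]" Q] assms by simp
qed

definition reaches :: "instr list \<Rightarrow> nat \<Rightarrow> config \<Rightarrow> config \<Rightarrow> bool" where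
  "reaches P t s s' \<longleftrightarrow> (step P ^^ t) s = s'"

lemma reaches_trans:
  assumes "reaches P t s s'" "reaches P u s' s''"
  shows "reaches P (t + u) s s''"
proof -
  have "(step P ^^ (u + t)) s = s''" using assms by (simp add: reaches_def funpow_add)
  then show ?thesis by (simp add: reaches_def add.commute)
qed

lemma reaches_step:
  assumes "p < length P" "P ! p = i" "exec i (config_of p s) = s'" 
  shows "reaches P 1 (config_of p s) s'"
  using assms by (simp add: reaches_def step_def halted_def config_of_def)

text \<open>\<open>consts_ok\<close> is what makes the copy, the decrement and the unconditional
  jump of a loop work; it survives because safe code with \<open>3 \<le> b\<close> writes no
  register below 3.\<close>

lemma reaches_code:
  assumes "located P p (code p c)" "safe b c" "3 \<le> b" "consts_ok N (fst s)"
  shows "reaches P (poly (run_time c) N) (config_of p s) (config_of (p + code_length c) (sem N c s))"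
  using assms
proof (induction c arbitrary: p b s)
  case (Prim i)
  have "exec i (config_of p s) = config_of (p + 1) (sem N (Prim i) s)"
    using Prim.prems by (cases i) (auto simp: config_of_def)
  with Prim.prems show ?case
    using reaches_step[of p P i s] located_Cons[of P p i "[]"] by simp
next
  case (Seq c d)
  have "consts_ok N (fst (sem N c s))"
    by (rule consts_ok_sem) (use Seq.prems in auto)
  moreover have "located P p (code p c)" "located P (p + code_length c) (code (p + code_length c) d)"
    using Seq.prems(1) located_append[of P p "code p c"] by auto
  ultimately have "reaches P (poly (run_time c) N) (config_of p s)
      (config_of (p + code_length c) (sem N c s))"
    "reaches P (poly (run_time d) N) (config_of (p + code_length c) (sem N c s))
      (config_of (p + code_length c + code_length d) (sem N d (sem N c s)))"
    using Seq.IH(1)[of p b s] Seq.IH(2)[of "p + code_length c" b "sem N c s"] Seq.prems by simp_all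
  from reaches_trans[OF this] show ?case by (simp add: add.assoc)
next
  case (Loop i c)
  let ?e = "p + code_length c + 4"
  let ?f = "\<lambda>k s. sem N c (set_reg i k s)"
  have i: "3 \<le> i" "safe (Suc i) c" using Loop.prems by auto
  have "located P p (Add i 1 0 # Jzero i ?e # Sub i i 2 # code (p + 3) c @ [Jzero 0 (p + 1)])"
    using Loop.prems(1) by simp
  note L0 = located_Cons[OF this]
  note L1 = located_Cons[OF L0(3)]
  note L2 = located_Cons[OF L1(3)]
  have "located P (p + 3) (code (p + 3) c @ [Jzero 0 (p + 1)])"
    using L2(3) by (simp add: numeral_3_eq_3)
  note L3 = located_append[OF this]
  have L4: "p + 3 + code_length c < length P" "P ! (p + 3 + code_length c) = Jzero 0 (p + 1)"
    using located_Cons[of P "p + 3 + code_length c"] L3(2) by auto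
  \<comment> \<open>Induction on the counter, entered at the test at \<open>p + 1\<close>; the final
    \<open>+ 1\<close> is the test that leaves the loop.\<close>
  have main: "reaches P (k * (poly (run_time c) N + 3) + 1) (config_of (p + 1) s)
      (config_of ?e (fold ?f (rev [0..<k]) s))"
    if "fst s i = k" "consts_ok N (fst s)" for k s
    using that
  proof (induction k arbitrary: s)
    case 0
    then show ?case using reaches_step[of "p + 1" P _ s] L1 by (simp add: config_of_def)
  next
    case (Suc k)
    let ?s = "set_reg i k s"
    have ok: "consts_ok N (fst ?s)" using Suc.prems i by (auto simp: consts_ok_def)
    have ok': "consts_ok N (fst (?f k s))"
      using consts_ok_sem[OF i(2) _ ok] i by simp
    have "reaches P 1 (config_of (p + 1) s) (config_of (p + 2) s)"
      using L1 Suc.prems by (intro reaches_step) (auto simp: config_of_def)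
    moreover have "reaches P 1 (config_of (p + 2) s) (config_of (p + 3) ?s)"
      using L2 Suc.prems 
      by (intro reaches_step[where i = "Sub i i 2"]) (auto simp: config_of_def consts_ok_def set_reg_def)
    moreover have "reaches P (poly (run_time c) N) (config_of (p + 3) ?s)
        (config_of (p + 3 + code_length c) (?f k s))"
      by (rule Loop.IH[OF L3(1) i(2) _ ok]) (use i in simp)
    moreover have "reaches P 1 (config_of (p + 3 + code_length c) (?f k s)) (config_of (p + 1) (?f k s))"
      using L4 ok' by (intro reaches_step) (auto simp: config_of_def consts_ok_def)
    moreover have "reaches P (k * (poly (run_time c) N + 3) + 1) (config_of (p + 1) (?f k s))
        (config_of ?e (fold ?f (rev [0..<k]) (?f k s)))"
      by (rule Suc.IH[OF _ ok']) (simp add: sem_frame[OF i(2)])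
    ultimately have "reaches P (1 + (1 + (poly (run_time c) N + (1 + (k * (poly (run_time c) N + 3) + 1)))))
        (config_of (p + 1) s) (config_of ?e (fold ?f (rev [0..<k]) (?f k s)))"
      by (blast intro: reaches_trans)
    then show ?case by (simp add: algebra_simps eval_nat_numeral)
  qed
  have "reaches P 1 (config_of p s) (config_of (p + 1) (set_reg i N s))"
    using L0 Loop.prems(4)
    by (intro reaches_step) (auto simp: config_of_def consts_ok_def set_reg_def)
  moreover have "reaches P (N * (poly (run_time c) N + 3) + 1) (config_of (p + 1) (set_reg i N s))
      (config_of ?e (sem N (Loop i c) s))"
    using main[of "set_reg i N s" N] Loop.prems(4) i by (auto simp: consts_ok_def)
  ultimately have "reaches P (1 + (N * (poly (run_time c) N + 3) + 1)) (config_of p s)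
      (config_of ?e (sem N (Loop i c) s))"
    by (rule reaches_trans)
  then show ?case by (simp add: algebra_simps)
qed

section \<open>Expressions with bounded sums\<close>

datatype expr =
    Var nat
  | Num nat
  | Plus expr expr
  | Minus expr expr
  | Read expr
  | Sum nat expr

primrec eval :: "nat \<Rightarrow> (nat \<Rightarrow> nat) \<Rightarrow> (nat \<Rightarrow> nat) \<Rightarrow> expr \<Rightarrow> nat" where
  "eval N m e (Var x) = e x"
| "eval N m e (Num k) = k"
| "eval N m e (Plus a b) = eval N m e a + eval N m e b"
| "eval N m e (Minus a b) = eval N m e a - eval N m e b"
| "eval N m e (Read a) = m (eval N m e a)"
| "eval N m e (Sum x a) = (\<Sum>k<N. eval N m (e(x := k)) a)"

text \<open>The map \<open>\<sigma>\<close> places the variables in registers below d; the value is left in register d.\<close>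

primrec compile :: "(nat \<Rightarrow> nat) \<Rightarrow> nat \<Rightarrow> expr \<Rightarrow> loop_prog" where
  "compile \<sigma> d (Var x) = Prim (Add d (\<sigma> x) 0)"
| "compile \<sigma> d (Num k) = Prim (Const d k)"
| "compile \<sigma> d (Plus a b) =
     Seq (compile \<sigma> d a) (Seq (compile \<sigma> (d + 1) b) (Prim (Add d d (d + 1))))"
| "compile \<sigma> d (Minus a b) =
     Seq (compile \<sigma> d a) (Seq (compile \<sigma> (d + 1) b) (Prim (Sub d d (d + 1))))"
| "compile \<sigma> d (Read a) = Seq (compile \<sigma> d a) (Prim (Load d d))"
| "compile \<sigma> d (Sum x a) =
     Seq (Prim (Const (d + 1) 0))
       (Seq (Loop d (Seq (compile (\<sigma>(x := d)) (d + 2) a) (Prim (Add (d + 1) (d + 1) (d + 2)))))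
         (Prim (Add d (d + 1) 0)))"

lemma safe_compile: "b \<le> d \<Longrightarrow> safe b (compile \<sigma> d a)"
  by (induction a arbitrary: \<sigma> b d) simp_all

text \<open>The left operand survives in \<open>d\<close> because the right one is compiled at
  \<open>d + 1\<close>. For \<open>Sum\<close>, register \<open>d\<close> holds the counter,
  \<open>d + 1\<close> the accumulator and \<open>d + 2\<close> the summand.\<close>

lemma sem_compile:
  assumes "\<And>x. \<sigma> x < d" "3 \<le> d" "consts_ok N (fst s)"
  shows "snd (sem N (compile \<sigma> d a) s) = snd s \<and>
         fst (sem N (compile \<sigma> d a) s) d = eval N (snd s) (\<lambda>x. fst s (\<sigma> x)) a"
  using assms
proof (induction a arbitrary: \<sigma> d s)
  case (Var x)
  then show ?case by (simp add: config_of_def consts_ok_def)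
next
  case (Num k)
  then show ?case by (simp add: config_of_def)
next
  case (Plus a b)
  let ?s = "sem N (compile \<sigma> d a) s"
  have "consts_ok N (fst ?s)"
    using safe_compile[OF order.refl] Plus.prems(2,3) by (rule consts_ok_sem)
  moreover have "fst ?s (\<sigma> x) = fst s (\<sigma> x)" for x
    using safe_compile[OF order.refl] Plus.prems(1) by (rule sem_frame)
  moreover have "fst (sem N (compile \<sigma> (d + 1) b) ?s) d = fst ?s d"
    using safe_compile[OF order.refl] by (rule sem_frame) simp
  ultimately show ?case
    using Plus.IH(1)[of \<sigma> d s] Plus.IH(2)[of \<sigma> "d + 1" ?s] Plus.prems
    by (simp add: config_of_def less_SucI)
next
  case (Minus a b)
  let ?s = "sem N (compile \<sigma> d a) s"
  have "consts_ok N (fst ?s)"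
    using safe_compile[OF order.refl] Minus.prems(2,3) by (rule consts_ok_sem)
  moreover have "fst ?s (\<sigma> x) = fst s (\<sigma> x)" for x
    using safe_compile[OF order.refl] Minus.prems(1) by (rule sem_frame)
  moreover have "fst (sem N (compile \<sigma> (d + 1) b) ?s) d = fst ?s d"
    using safe_compile[OF order.refl] by (rule sem_frame) simp
  ultimately show ?case
    using Minus.IH(1)[of \<sigma> d s] Minus.IH(2)[of \<sigma> "d + 1" ?s] Minus.prems
    by (simp add: config_of_def less_SucI)
next
  case (Read a)
  then show ?case using Read.IH[of \<sigma> d s] by (simp add: config_of_def)
next
  case (Sum x a)
  let ?c = "compile (\<sigma>(x := d)) (d + 2) a"
  let ?body = "Seq ?c (Prim (Add (d + 1) (d + 1) (d + 2)))"
  let ?f = "\<lambda>k s. sem N ?body (set_reg d k s)"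
  define s\<^sub>0 where "s\<^sub>0 = set_reg d N (set_reg (d + 1) 0 s)"
  let ?v = "\<lambda>k. eval N (snd s) ((\<lambda>y. fst s (\<sigma> y))(x := k)) a"
  have loop: "snd (fold ?f ks s') = snd s \<and> (\<forall>y<d. fst (fold ?f ks s') y = fst s y) \<and>
      fst (fold ?f ks s') (d + 1) = fst s' (d + 1) + sum_list (map ?v ks)"
    if "snd s' = snd s" "\<forall>y<d. fst s' y = fst s y" for ks s'
    using that
  proof (induction ks arbitrary: s')
    case (Cons k ks)
    let ?s = "set_reg d k s'"
    have ok: "consts_ok N (fst ?s)" and \<sigma>: "\<And>y. (\<sigma>(x := d)) y < d + 2"
      using Sum.prems Cons.prems by (auto simp: consts_ok_def less_SucI)
    \<comment> \<open>No old variable lives in \<open>d\<close>, so giving the counter this register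
      is exactly the update of \<open>x\<close> in the environment.\<close>
    have "(\<lambda>y. fst ?s ((\<sigma>(x := d)) y)) = (\<lambda>y. fst s (\<sigma> y))(x := k)"
      using Sum.prems(1) Cons.prems by (auto simp: fun_eq_iff dest: less_imp_neq)
    then have "snd (sem N ?c ?s) = snd s" "fst (sem N ?c ?s) (d + 2) = ?v k"
      using Sum.IH[of "\<sigma>(x := d)" "d + 2" ?s, OF \<sigma> _ ok] Sum.prems(2) Cons.prems(1)
      by (simp_all only: snd_set_reg)
    moreover have "fst (sem N ?c ?s) y = fst ?s y" if "y < d + 2" for y
      using safe_compile[OF order.refl] that by (rule sem_frame)
    ultimately have "snd (?f k s') = snd s" "\<forall>y<d. fst (?f k s') y = fst s y"
      "fst (?f k s') (d + 1) = fst s' (d + 1) + ?v k"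
      using Cons.prems by (simp_all add: config_of_def)
    then show ?case using Cons.IH[of "?f k s'"] by (simp del: sem.simps fun_upd_apply)
  qed simp
  have "sum_list (map ?v (rev [0..<N])) = (\<Sum>k<N. ?v k)"
    by (simp add: rev_map[symmetric] interv_sum_list_conv_sum_set_nat atLeast0LessThan)
  moreover have "consts_ok N (fst (fold ?f (rev [0..<N]) s\<^sub>0))"
    using loop[of s\<^sub>0 "rev [0..<N]"] Sum.prems by (auto simp: s\<^sub>0_def consts_ok_def)
  moreover have "sem N (compile \<sigma> d (Sum x a)) s =
      set_reg d (fst (fold ?f (rev [0..<N]) s\<^sub>0) (d + 1) + fst (fold ?f (rev [0..<N]) s\<^sub>0) 0)
        (fold ?f (rev [0..<N]) s\<^sub>0)"
    by (simp add: config_of_def s\<^sub>0_def set_reg_def)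
  ultimately show ?case
    using loop[of s\<^sub>0 "rev [0..<N]"]
    by (simp add: s\<^sub>0_def consts_ok_def del: sem.simps)
qed

section \<open>Statements that write to memory\<close>

datatype stmt =
    Write expr expr
  | For nat stmt

text \<open>Unlike summands, writes need not commute, so the descending order of the machine is part
  of the semantics; filling the table relies on it.\<close>

primrec run :: "nat \<Rightarrow> (nat \<Rightarrow> nat) \<Rightarrow> stmt \<Rightarrow> (nat \<Rightarrow> nat) \<Rightarrow> nat \<Rightarrow> nat" where
  "run N e (Write a v) m = m(eval N m e a := eval N m e v)"
| "run N e (For x c) m = fold (\<lambda>k. run N (e(x := k)) c) (rev [0..<N]) m"

primrec compile_stmt :: "(nat \<Rightarrow> nat) \<Rightarrow> nat \<Rightarrow> stmt \<Rightarrow> loop_prog" where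
  "compile_stmt \<sigma> d (Write a v) =
     Seq (compile \<sigma> d a) (Seq (compile \<sigma> (d + 1) v) (Prim (Store d (d + 1))))"
| "compile_stmt \<sigma> d (For x c) = Loop d (compile_stmt (\<sigma>(x := d)) (d + 1) c)"

lemma safe_compile_stmt: "b \<le> d \<Longrightarrow> safe b (compile_stmt \<sigma> d c)"
  by (induction c arbitrary: \<sigma> b d) (simp_all add: safe_compile)

lemma sem_compile_stmt:
  assumes "\<And>x. \<sigma> x < d" "3 \<le> d" "consts_ok N (fst s)"
  shows "snd (sem N (compile_stmt \<sigma> d c) s) = run N (\<lambda>x. fst s (\<sigma> x)) c (snd s)"
  using assms
proof (induction c arbitrary: \<sigma> d s)
  case (Write a v)
  let ?s = "sem N (compile \<sigma> d a) s"
  have "consts_ok N (fst ?s)"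
    using safe_compile[OF order.refl] Write.prems(2,3) by (rule consts_ok_sem)
  moreover have "fst ?s (\<sigma> x) = fst s (\<sigma> x)" for x
    using safe_compile[OF order.refl] Write.prems(1) by (rule sem_frame)
  moreover have "fst (sem N (compile \<sigma> (d + 1) v) ?s) d = fst ?s d"
    using safe_compile[OF order.refl] by (rule sem_frame) simp
  ultimately show ?case
    using sem_compile[of \<sigma> d N s a] sem_compile[of \<sigma> "d + 1" N ?s v] Write.prems
    by (simp add: config_of_def less_SucI)
next
  case (For x c)
  let ?c = "compile_stmt (\<sigma>(x := d)) (d + 1) c"
  have "snd (fold (\<lambda>k s. sem N ?c (set_reg d k s)) ks s') =
      fold (\<lambda>k. run N ((\<lambda>y. fst s (\<sigma> y))(x := k)) c) ks (snd s')"
    if "\<forall>y<d. fst s' y = fst s y" for ks s'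
    using that
  proof (induction ks arbitrary: s')
    case (Cons k ks)
    let ?s = "set_reg d k s'"
    have ok: "consts_ok N (fst ?s)" and \<sigma>: "\<And>y. (\<sigma>(x := d)) y < d + 1"
      using For.prems Cons.prems by (auto simp: consts_ok_def less_SucI)
    have "(\<lambda>y. fst ?s ((\<sigma>(x := d)) y)) = (\<lambda>y. fst s (\<sigma> y))(x := k)"
      using For.prems(1) Cons.prems by (auto simp: fun_eq_iff dest: less_imp_neq)
    then have "snd (sem N ?c ?s) = run N ((\<lambda>y. fst s (\<sigma> y))(x := k)) c (snd s')"
      using For.IH[of "\<sigma>(x := d)" "d + 1" ?s, OF \<sigma> _ ok] For.prems(2)
      by (simp only: snd_set_reg)
    moreover have "\<forall>y<d. fst (sem N ?c ?s) y = fst s y"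
      using sem_frame[OF safe_compile_stmt[OF order.refl], of _ "d + 1" N "\<sigma>(x := d)" c ?s] Cons.prems by simp
    ultimately show ?case using Cons.IH[of "sem N ?c ?s"] by (simp del: fun_upd_apply)
  qed simp
  from this[of "set_reg d N s"] show ?case by simp
qed

text \<open>All variables start out mapped to register 0, which holds 0, so free variables of
  \<open>c\<close> and \<open>a\<close> have value 0. The polynomial is the exact running time of
  the loops plus three further instructions.\<close>

theorem decides_in_poly_timeI:
  assumes "\<And>G N. C G \<Longrightarrow> pverts G = {..<N} \<Longrightarrow>
      eval N (run N (\<lambda>_. 0) c (matrix_input G)) (\<lambda>_. 0) a = of_bool (Q G)"
  shows "\<exists>P. decides_in_poly_time P C Q"
proof -
  define p where "p = Seq (compile_stmt (\<lambda>_. 0) 3 c) (compile (\<lambda>_. 0) 3 a)"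
  \<comment> \<open>\<open>Load 1 0\<close> fetches N from cell 0, as register 0 is still zero. The
    loops need register 0 to stay zero, so the answer is computed in register 3 and moved at the
    very end.\<close>
  define P where "P = [Load 1 0, Const 2 1] @ code 2 p @ [Add 0 3 0]"
  have safe: "safe 3 p"
    by (simp add: p_def safe_compile safe_compile_stmt)
  have len: "length P = code_length p + 3"
    by (simp add: P_def)
  have "\<exists>t\<le>poly (run_time p + [:3:]) (card (pverts G)).
      let s = (step P ^^ t) (initial G) in halted P s \<and> reg s 0 = of_bool (Q G)"
    if G: "C G" "pverts G = {..<card (pverts G)}" for G
  proof -
    define N where "N = card (pverts G)"
    define s\<^sub>0 :: store where "s\<^sub>0 = ((\<lambda>_. 0)(1 := N, 2 := 1), matrix_input G)"
    let ?s = "sem N p s\<^sub>0"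
    have ok: "consts_ok N (fst s\<^sub>0)" by (simp add: s\<^sub>0_def consts_ok_def)
    have "matrix_input G 0 = N" by (simp add: matrix_input_def N_def Let_def)
    then have "reaches P 2 (initial G) (config_of 2 s\<^sub>0)"
      by (simp add: reaches_def numeral_2_eq_2 step_def halted_def initial_def P_def
          config_of_def s\<^sub>0_def)
    moreover have "located P 2 (code 2 p)"
      unfolding located_def P_def by (metis length_Cons list.size(3) numeral_2_eq_2)
    from reaches_code[OF this safe _ ok]
    have "reaches P (poly (run_time p) N) (config_of 2 s\<^sub>0) (config_of (2 + code_length p) ?s)"
      by simp
    moreover have "reaches P 1 (config_of (2 + code_length p) ?s)
        (config_of (3 + code_length p) (set_reg 0 (fst ?s 3 + fst ?s 0) ?s))"
      by (rule reaches_step[where i = "Add 0 3 0"])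
        (simp_all add: len, simp_all add: P_def nth_append config_of_def)
    ultimately have "reaches P (2 + (poly (run_time p) N + 1)) (initial G)
        (config_of (3 + code_length p) (set_reg 0 (fst ?s 3 + fst ?s 0) ?s))"
      by (blast intro: reaches_trans)
    moreover have "fst ?s 3 + fst ?s 0 = of_bool (Q G)"
    proof -
      let ?s' = "sem N (compile_stmt (\<lambda>_. 0) 3 c) s\<^sub>0"
      have ok': "consts_ok N (fst ?s')" 
        using safe_compile_stmt[OF order.refl] _ ok by (rule consts_ok_sem) simp
      have "snd ?s' = run N (\<lambda>_. 0) c (matrix_input G)"
        using sem_compile_stmt[OF _ _ ok, of "\<lambda>_. 0" 3 c] by (simp add: s\<^sub>0_def)
      then have "fst ?s 3 = of_bool (Q G)"
        using sem_compile[OF _ _ ok', of "\<lambda>_. 0" 3 a] assms[OF G(1), of N] G(2) ok'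
        by (simp add: p_def N_def consts_ok_def)
      moreover have "consts_ok N (fst ?s)"
        using safe _ ok by (rule consts_ok_sem) simp
      ultimately show ?thesis by (simp add: consts_ok_def)
    qed
    ultimately show ?thesis
      by (intro exI[of _ "2 + (poly (run_time p) N + 1)"])
        (simp add: reaches_def Let_def halted_def config_of_def len N_def)
  qed
  then show ?thesis unfolding decides_in_poly_time_def by blast
qed

section \<open>Distances in connected graphs\<close>

text \<open>The path metric in natural numbers: powers of the arc relation support induction,
  whereas \<open>path_dist\<close> is an infimum of extended reals over walks.\<close>

definition hop_dist :: "'a pair_pre_digraph \<Rightarrow> 'a \<Rightarrow> 'a \<Rightarrow> nat" where
  "hop_dist G u v = (LEAST k. (u, v) \<in> parcs G ^^ k)"

lemma (in pair_wf_digraph) relpow_iff_awalk: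
  assumes "u \<in> pverts G"
  shows "(u, v) \<in> parcs G ^^ k \<longleftrightarrow> (\<exists>p. awalk u p v \<and> length p = k)"
  using assms
proof (induction k arbitrary: u)
  case 0
  then show ?case by (auto simp: awalk_Nil_iff)
next
  case (Suc k)
  show ?case
  proof
    assume "(u, v) \<in> parcs G ^^ Suc k"
    then obtain w where w: "(u, w) \<in> parcs G" "(w, v) \<in> parcs G ^^ k"
      by (meson relpow_Suc_D2)
    with Suc.IH in_arcsD2 obtain p where "awalk w p v" "length p = k" by blast
    with w have "awalk u ((u, w) # p) v" "length ((u, w) # p) = Suc k"
      by (auto simp: awalk_Cons_iff)
    then show "\<exists>p. awalk u p v \<and> length p = Suc k" by blast
  next
    assume "\<exists>p. awalk u p v \<and> length p = Suc k"
    then obtain a p where "awalk u (a # p) v" "length p = k"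
      by (metis length_Suc_conv)
    then have "a \<in> parcs G" "fst a = u" "awalk (snd a) p v" by (auto simp: awalk_Cons_iff)
    then have "(u, snd a) \<in> parcs G" "(snd a, v) \<in> parcs G ^^ k"
      using Suc.IH[of "snd a"] in_arcsD2 \<open>length p = k\<close> by (metis prod.collapse)+
    then show "(u, v) \<in> parcs G ^^ Suc k" by (rule relpow_Suc_I2)
  qed
qed

lemma (in wf_digraph) awalk_cost_unit: "awalk_cost (\<lambda>_. 1) p = real (length p)"
  by (induction p) auto

text \<open>A symmetric connected graph is strongly connected, and a path without repeated vertices
  has fewer arcs than the graph has vertices. All truncations at N rest on this bound.\<close>

lemma fin_conn_graph_awalk:
  assumes "fin_conn_graph G" "u \<in> pverts G" "v \<in> pverts G"
  obtains p where "pre_digraph.awalk (with_proj G) u p v" "length p < card (pverts G)"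
proof -
  interpret pair_graph G using assms(1) by (simp add: fin_conn_graph_def)
  have "strongly_connected (with_proj G)"
    using assms(1) by (intro symmetric_connected_imp_strongly_connected sym_arcs)
      (simp add: fin_conn_graph_def)
  then have "reachable (with_proj G) u v" using assms(2,3) by (auto simp: strongly_connected_def)
  then obtain p where "apath u p v" using reachable_apath by blast
  then show ?thesis using that length_apath_less[of u p v] by (auto simp: apath_def)
qed

lemma relpow_hop_dist:
  assumes "fin_conn_graph G" "u \<in> pverts G" "v \<in> pverts G"
  shows "(u, v) \<in> parcs G ^^ hop_dist G u v"
    and "hop_dist G u v < card (pverts G)"
proof -
  interpret pair_graph G using assms(1) by (simp add: fin_conn_graph_def)
  obtain p where "awalk u p v" "length p < card (pverts G)"
    using fin_conn_graph_awalk[OF assms] .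
  then have p: "(u, v) \<in> parcs G ^^ length p" "length p < card (pverts G)"
    using relpow_iff_awalk[OF assms(2)] by auto
  show "(u, v) \<in> parcs G ^^ hop_dist G u v"
    unfolding hop_dist_def using p(1) by (rule LeastI)
  have "hop_dist G u v \<le> length p"
    unfolding hop_dist_def using p(1) by (rule Least_le)
  with p(2) show "hop_dist G u v < card (pverts G)" by simp
qed

lemma hop_dist_le: "(u, v) \<in> parcs G ^^ k \<Longrightarrow> hop_dist G u v \<le> k"
  unfolding hop_dist_def by (rule Least_le)

lemma path_dist_eq_hop_dist:
  assumes "fin_conn_graph G" "u \<in> pverts G" "v \<in> pverts G"
  shows "path_dist G u v = ereal (real (hop_dist G u v))"
proof -
  interpret pair_graph G using assms(1) by (simp add: fin_conn_graph_def)
  obtain p where p: "awalk u p v" "length p = hop_dist G u v"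
    using relpow_hop_dist(1)[OF assms] relpow_iff_awalk[OF assms(2)] by auto
  have le: "hop_dist G u v \<le> length q" if "awalk u q v" for q
    using that relpow_iff_awalk[OF assms(2)] hop_dist_le by metis
  show ?thesis
    unfolding path_dist_def \<mu>_def awalk_cost_unit
  proof (rule antisym)
    show "(INF q\<in>{q. awalk u q v}. ereal (real (length q))) \<le> ereal (real (hop_dist G u v))"
      using p by (intro INF_lower2[of p]) auto
    show "ereal (real (hop_dist G u v)) \<le> (INF q\<in>{q. awalk u q v}. ereal (real (length q)))"
      using le by (intro INF_greatest) auto
  qed
qed

text \<open>Cut off the last arc of a shortest walk. This recursion fills the distance
  table.\<close>

lemma hop_dist_le_Suc_iff:
  assumes "fin_conn_graph G" "u \<in> pverts G" "v \<in> pverts G"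
  shows "hop_dist G u v \<le> Suc k \<longleftrightarrow>
    hop_dist G u v \<le> k \<or> (\<exists>w\<in>pverts G. hop_dist G u w \<le> k \<and> (w, v) \<in> parcs G)" (is "?L \<longleftrightarrow> ?R")
proof
  interpret pair_graph G using assms(1) by (simp add: fin_conn_graph_def)
  assume ?L
  show ?R
  proof (cases "hop_dist G u v \<le> k")
    case False
    with \<open>?L\<close> have "hop_dist G u v = Suc k" by simp
    with relpow_hop_dist(1)[OF assms] obtain w where "(u, w) \<in> parcs G ^^ k" "(w, v) \<in> parcs G"
      by auto
    then show ?thesis using hop_dist_le in_arcsD1 by metis
  qed simp
next
  assume ?R
  then show ?L
  proof
    assume "\<exists>w\<in>pverts G. hop_dist G u w \<le> k \<and> (w, v) \<in> parcs G"
    then obtain w where w: "w \<in> pverts G" "hop_dist G u w \<le> k" "(w, v) \<in> parcs G" by blast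
    then have "(u, v) \<in> parcs G ^^ Suc (hop_dist G u w)"
      using relpow_hop_dist(1)[OF assms(1,2) w(1)] by auto
    from hop_dist_le[OF this] w(2) show ?thesis by simp
  qed simp
qed

lemma hop_dist_eq_0_iff:
  assumes "fin_conn_graph G" "u \<in> pverts G" "v \<in> pverts G"
  shows "hop_dist G u v = 0 \<longleftrightarrow> u = v"
proof
  assume "hop_dist G u v = 0"
  then show "u = v" using relpow_hop_dist(1)[OF assms] by simp
next
  assume "u = v"
  then show "hop_dist G u v = 0" using hop_dist_le[of u v 0 G] by simp
qed

section \<open>Partite classes of a connected bipartite graph\<close>

lemma bipartition_parity:
  assumes "bipartition G X Y" "u \<in> X" "(u, v) \<in> parcs G ^^ k"
  shows "if even k then v \<in> X else v \<in> Y"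
  using assms(3)
proof (induction k arbitrary: v)
  case 0
  then show ?case using assms(2) by simp
next
  case (Suc k)
  then obtain w where "(u, w) \<in> parcs G ^^ k" "(w, v) \<in> parcs G" by auto
  then show ?case using Suc.IH[of w] assms(1) by (auto simp: bipartition_def split: if_splits)
qed

lemma bipartition_unique:
  assumes "fin_conn_graph G" "bipartition G X Y" "z \<in> X"
  shows "X = {v \<in> pverts G. hop_dist G z v mod 2 = 0}"
    and "Y = {v \<in> pverts G. hop_dist G z v mod 2 = 1}"
proof -
  have "z \<in> pverts G" using assms by (auto simp: bipartition_def)
  then have par: "if even (hop_dist G z v) then v \<in> X else v \<in> Y" if "v \<in> pverts G" for v
    using bipartition_parity[OF assms(2,3) relpow_hop_dist(1)[OF assms(1) _ that]] by blast
  have XY: "X \<union> Y = pverts G" "X \<inter> Y = {}"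
    using assms(2) by (auto simp: bipartition_def)
  have "v \<in> X \<longleftrightarrow> v \<in> pverts G \<and> even (hop_dist G z v)"
    "v \<in> Y \<longleftrightarrow> v \<in> pverts G \<and> odd (hop_dist G z v)" for v
    using par[of v] XY by (cases "even (hop_dist G z v)"; auto)+
  then show "X = {v \<in> pverts G. hop_dist G z v mod 2 = 0}"
    "Y = {v \<in> pverts G. hop_dist G z v mod 2 = 1}"
    by (simp_all add: set_eq_iff even_iff_mod_2_eq_zero odd_iff_mod_2_eq_one)
qed

lemma bipartition_sym: "bipartition G X Y \<longleftrightarrow> bipartition G Y X"
  by (auto simp: bipartition_def)

text \<open>Some bipartition exists, and after exchanging its sides \<open>z\<close> lies in the
  first; so both parity classes occur, and by uniqueness no other set does.\<close>

lemma partite_class_iff: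
  assumes "fin_conn_graph G" "bipartite G" "z \<in> pverts G"
  shows "partite_class G X \<longleftrightarrow> (\<exists>b\<in>{0, 1}. X = {v \<in> pverts G. hop_dist G z v mod 2 = b})"
proof -
  obtain A B where AB: "bipartition G A B" "z \<in> A"
  proof -
    obtain A B where "bipartition G A B" using assms(2) by (auto simp: bipartite_def)
    moreover from this have "z \<in> A \<or> z \<in> B" using assms(3) by (auto simp: bipartition_def)
    ultimately show ?thesis using that[of A B] that[of B A] bipartition_sym[of G A B] by blast
  qed
  define E where "E b = {v \<in> pverts G. hop_dist G z v mod 2 = b}" for b
  have u: "C = E 0 \<and> D = E 1" if "bipartition G C D" "z \<in> C" for C D
    using bipartition_unique[OF assms(1) that] by (simp add: E_def)
  have "partite_class G X \<longleftrightarrow> X = E 0 \<or> X = E 1"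
  proof
    assume "partite_class G X"
    then obtain Y where Y: "bipartition G X Y" by (auto simp: partite_class_def)
    then have "z \<in> X \<or> z \<in> Y" using assms(3) by (auto simp: bipartition_def)
    then show "X = E 0 \<or> X = E 1"
      using u[of X Y] u[of Y X] Y bipartition_sym[of G X Y] by blast
  next
    assume "X = E 0 \<or> X = E 1"
    then have "X = A \<or> X = B" using u[OF AB] by simp
    moreover have "partite_class G A" "partite_class G B"
      using AB(1) bipartition_sym[of G A B] by (auto simp: partite_class_def)
    ultimately show "partite_class G X" by blast
  qed
  then show ?thesis by (simp add: E_def)
qed

text \<open>Every radius \<open>\<ge> s\<close> may be replaced by some \<open>\<rho> + s\<close> with \<open>\<rho> < N\<close>, because all distances are
  less than N.\<close>

definition bounded_helly :: "nat pair_pre_digraph \<Rightarrow> nat \<Rightarrow> nat \<Rightarrow> nat \<Rightarrow> nat \<Rightarrow> nat set \<Rightarrow> bool" where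
  "bounded_helly G N n m s X \<longleftrightarrow>
     (\<forall>c \<rho>. (\<forall>i<n. c i < N \<and> \<rho> i < N) \<longrightarrow>
        (\<forall>S\<subseteq>{..<n}. card S = m \<longrightarrow> (\<exists>v<N. v \<in> X \<and> (\<forall>i\<in>S. hop_dist G (c i) v \<le> \<rho> i + s))) \<longrightarrow>
        (\<exists>v<N. v \<in> X \<and> (\<forall>i<n. hop_dist G (c i) v \<le> \<rho> i + s)))"

text \<open>Covers both Helly properties: \<open>s\<close> is the least admissible radius and
  \<open>X\<close> the set in which common points are sought. By \<open>0 < m\<close> and
  \<open>m < n\<close> all index sets are nonempty; an intersection over the empty set would be the
  whole type.\<close>

lemma bounded_helly_iff:
  assumes G: "fin_conn_graph G" "pverts G = {..<N}" and "0 < m" "m < n"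
  shows "bounded_helly G N n m s X \<longleftrightarrow>
    (\<forall>c r. (\<forall>i<n. c i \<in> pverts G \<and> s \<le> r i) \<longrightarrow>
        (\<forall>S\<subseteq>{..<n}. card S = m \<longrightarrow> (\<Inter>i\<in>S. closed_ball G (c i) (r i) \<inter> X) \<noteq> {}) \<longrightarrow>
        (\<Inter>i<n. closed_ball G (c i) (r i) \<inter> X) \<noteq> {})" (is "_ \<longleftrightarrow> ?R")
proof -
  have dist_less: "hop_dist G u v < N" if "u < N" "v < N" for u v
    using relpow_hop_dist(2)[OF G(1)] that by (simp add: G(2))
  have ball: "(\<Inter>i\<in>S. closed_ball G (c i) (r i) \<inter> X) \<noteq> {} \<longleftrightarrow>
      (\<exists>v<N. v \<in> X \<and> (\<forall>i\<in>S. hop_dist G (c i) v \<le> r i))"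
    if "\<forall>i<n. c i < N" "S \<subseteq> {..<n}" "S \<noteq> {}" for S c and r :: "nat \<Rightarrow> nat"
  proof -
    have "v \<in> closed_ball G (c i) (r i) \<longleftrightarrow> v < N \<and> hop_dist G (c i) v \<le> r i" if "i \<in> S" for i v
    proof -
      from that \<open>\<forall>i<n. c i < N\<close> \<open>S \<subseteq> {..<n}\<close> have "c i < N" by blast
      with path_dist_eq_hop_dist[OF G(1), of "c i" v] show ?thesis
        by (simp add: closed_ball_def G(2) cong: conj_cong)
    qed
    moreover have "(\<Inter>i\<in>S. closed_ball G (c i) (r i) \<inter> X) \<noteq> {} \<longleftrightarrow>
        (\<exists>v. \<forall>i\<in>S. v \<in> closed_ball G (c i) (r i) \<and> v \<in> X)"
      by blast
    ultimately have "(\<Inter>i\<in>S. closed_ball G (c i) (r i) \<inter> X) \<noteq> {} \<longleftrightarrow>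
        (\<exists>v. \<forall>i\<in>S. (v < N \<and> hop_dist G (c i) v \<le> r i) \<and> v \<in> X)"
      by (simp cong: ball_cong)
    then show ?thesis using \<open>S \<noteq> {}\<close> by blast
  qed
  have ne: "S \<noteq> {}" if "card S = m" for S :: "nat set"
    using that \<open>0 < m\<close> by auto
  have n: "{..<n} \<noteq> {}" using \<open>m < n\<close> by auto
  show ?thesis
  proof
    assume L: "bounded_helly G N n m s X"
    show ?R
    proof (intro allI impI)
      fix c r
      assume cr: "\<forall>i<n. c i \<in> pverts G \<and> s \<le> r i"
        and H: "\<forall>S\<subseteq>{..<n}. card S = m \<longrightarrow> (\<Inter>i\<in>S. closed_ball G (c i) (r i) \<inter> X) \<noteq> {}"
      from cr have c: "\<forall>i<n. c i < N" by (simp add: G(2))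
      \<comment> \<open>If the cap \<open>N - 1\<close> takes effect, both radii are at least
        \<open>N - 1\<close>, so the ball is the whole graph before and after.\<close>
      define \<rho> where "\<rho> i = min (r i - s) (N - 1)" for i
      have \<rho>: "hop_dist G (c i) v \<le> r i \<longleftrightarrow> hop_dist G (c i) v \<le> \<rho> i + s" if "i < n" "v < N" for i v
      proof -
        from that c cr have "s \<le> r i" "hop_dist G (c i) v < N" by (simp_all add: dist_less)
        then show ?thesis unfolding \<rho>_def min_def by (split if_split) linarith
      qed
      have "\<forall>i<n. c i < N \<and> \<rho> i < N" using c by (auto simp: \<rho>_def)
      moreover have "\<exists>v<N. v \<in> X \<and> (\<forall>i\<in>S. hop_dist G (c i) v \<le> \<rho> i + s)"
        if S: "S \<subseteq> {..<n}" "card S = m" for S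
      proof -
        obtain v where "v < N" "v \<in> X" "\<forall>i\<in>S. hop_dist G (c i) v \<le> r i"
          using H[rule_format, OF S] ball[OF c S(1) ne[OF S(2)], of r] by blast
        moreover from this have "\<forall>i\<in>S. hop_dist G (c i) v \<le> \<rho> i + s"
          using \<rho> S(1) by blast
        ultimately show ?thesis by blast
      qed
      ultimately have "\<exists>v<N. v \<in> X \<and> (\<forall>i<n. hop_dist G (c i) v \<le> \<rho> i + s)"
        using L unfolding bounded_helly_def by blast
      then show "(\<Inter>i<n. closed_ball G (c i) (r i) \<inter> X) \<noteq> {}"
        using ball[OF c subset_refl n, of r] \<rho> by blast
    qed
  next
    assume ?R
    show "bounded_helly G N n m s X"
      unfolding bounded_helly_def
    proof (intro allI impI)
      fix c \<rho>
      assume c\<rho>: "\<forall>i<n. c i < N \<and> \<rho> i < N"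
        and H: "\<forall>S\<subseteq>{..<n}. card S = m \<longrightarrow>
          (\<exists>v<N. v \<in> X \<and> (\<forall>i\<in>S. hop_dist G (c i) v \<le> \<rho> i + s))"
      from c\<rho> have c: "\<forall>i<n. c i < N" by simp
      have "\<forall>S\<subseteq>{..<n}. card S = m \<longrightarrow> (\<Inter>i\<in>S. closed_ball G (c i) (\<rho> i + s) \<inter> X) \<noteq> {}"
        using H ball[OF c _ ne, of _ "\<lambda>i. \<rho> i + s"] by blast
      then have "(\<Inter>i<n. closed_ball G (c i) (\<rho> i + s) \<inter> X) \<noteq> {}"
        using \<open>?R\<close>[THEN spec, THEN spec, of c "\<lambda>i. \<rho> i + s"] c unfolding G(2) by simp
      then show "\<exists>v<N. v \<in> X \<and> (\<forall>i<n. hop_dist G (c i) v \<le> \<rho> i + s)"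
        using ball[OF c subset_refl n, of "\<lambda>i. \<rho> i + s"] by blast
    qed
  qed
qed

lemma helly_iff_bounded_helly:
  assumes "fin_conn_graph G" "pverts G = {..<N}" "0 < m" "m < n"
  shows "helly n m G \<longleftrightarrow> bounded_helly G N n m 1 UNIV"
  by (simp add: helly_def bounded_helly_iff[OF assms])

lemma bipartite_helly_iff_bounded_helly:
  assumes "fin_conn_graph G" "bipartite G" "pverts G = {..<N}" "0 < m" "m < n"
  shows "bipartite_helly n m G \<longleftrightarrow>
    (\<forall>b\<in>{0, 1}. bounded_helly G N n m 0 {v. hop_dist G 0 v mod 2 = b})"
proof -
  have "pverts G \<noteq> {}"
    using assms(1) by (simp add: fin_conn_graph_def connected_def strongly_connected_def)
  then have "0 \<in> pverts G" by (auto simp: assms(3))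
  note iff = partite_class_iff[OF assms(1,2) this]
  have "bounded_helly G N n m 0 {v \<in> pverts G. hop_dist G 0 v mod 2 = b} \<longleftrightarrow>
      bounded_helly G N n m 0 {v. hop_dist G 0 v mod 2 = b}" for b
    unfolding bounded_helly_def assms(3) by (simp cong: conj_cong)
  moreover have "bipartite_helly n m G \<longleftrightarrow>
      (\<forall>X. partite_class G X \<longrightarrow> bounded_helly G N n m 0 X)"
    unfolding bounded_helly_iff[OF assms(1,3-5)] bipartite_helly_def by auto
  ultimately show ?thesis by (auto simp: iff)
qed

section \<open>The distance table\<close>

abbreviation holds :: "nat \<Rightarrow> (nat \<Rightarrow> nat) \<Rightarrow> (nat \<Rightarrow> nat) \<Rightarrow> expr \<Rightarrow> bool" where
  "holds N m e a \<equiv> 0 < eval N m e a"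

text \<open>With nonzero as true, \<open>Plus\<close> is disjunction. \<open>Neg\<close> always
  yields 0 or 1, so a double negation normalises a truth value.\<close>

definition "Neg a = Minus (Num 1) a"
definition "Conj a b = Neg (Plus (Neg a) (Neg b))"
definition "Exists x a = Sum x a"
definition "Leq a b = Neg (Minus a b)"
definition "Equal a b = Conj (Leq a b) (Leq b a)"

lemma eval_Neg: "eval N m e (Neg a) = of_bool (\<not> holds N m e a)"
  by (simp add: Neg_def)

lemma holds_simps [simp]:
  "holds N m e (Neg a) \<longleftrightarrow> \<not> holds N m e a"
  "holds N m e (Conj a b) \<longleftrightarrow> holds N m e a \<and> holds N m e b"
  "holds N m e (Leq a b) \<longleftrightarrow> eval N m e a \<le> eval N m e b"
  "holds N m e (Equal a b) \<longleftrightarrow> eval N m e a = eval N m e b"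
  "holds N m e (Exists x a) \<longleftrightarrow> (\<exists>k<N. holds N m (e(x := k)) a)"
  using sum_eq_0_iff[of "{..<N}" "\<lambda>k. eval N m (e(x := k)) a"]
  by (auto simp: Neg_def Conj_def Leq_def Equal_def Exists_def simp flip: neq0_conv)

text \<open>The matrix entry (u, v) is stored in cell \<open>address N 0 u v\<close>; the table consists of the
  layers 1, ..., N behind it, where \<open>address N l u v\<close> records whether the distance from u to v is at
  most N - l. Layer N + 1 is read but never written: it is zero, as for "distance at most -1".
  Since loops count down, the table is filled from the highest address to the lowest.\<close>

definition address :: "nat \<Rightarrow> nat \<Rightarrow> nat \<Rightarrow> nat \<Rightarrow> nat" where
  "address N l u v = 1 + ((l * N + u) * N + v)"

definition table :: "nat pair_pre_digraph \<Rightarrow> nat \<Rightarrow> nat \<Rightarrow> nat" where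
  "table G N a = of_bool ((a - 1) div N div N \<le> N \<and>
     hop_dist G ((a - 1) div N mod N) ((a - 1) mod N) \<le> N - (a - 1) div N div N)"

text \<open>The invariant of the descending fill, with \<open>b\<close> the boundary between
  finished cells and input.\<close>

definition partial_table :: "nat pair_pre_digraph \<Rightarrow> nat \<Rightarrow> nat \<Rightarrow> nat \<Rightarrow> nat" where
  "partial_table G N b a = (if b \<le> a then table G N a else matrix_input G a)"

lemma table_address:
  assumes "u < N" "v < N"
  shows "table G N (address N l u v) = of_bool (l \<le> N \<and> hop_dist G u v \<le> N - l)"
  using assms by (simp add: table_def address_def)

lemma matrix_input_address:
  assumes "pverts G = {..<N}" "u < N" "v < N"
  shows "matrix_input G (address N 0 u v) = of_bool ((u, v) \<in> parcs G)"
proof -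
  have "u * N + v < Suc u * N" using assms by simp
  also have "\<dots> \<le> N * N" using assms by (intro mult_le_mono1) simp
  finally show ?thesis using assms by (simp add: matrix_input_def address_def)
qed

lemma address_less:
  assumes "l < l'" "u < N" "v < N"
  shows "address N l u v < address N l' u' v'"
proof -
  have "(l * N + u) * N + v < Suc (l * N + u) * N" using assms by simp
  also have "\<dots> \<le> (Suc l * N) * N" using assms by (intro mult_le_mono1) simp
  also have "\<dots> \<le> (l' * N) * N" using assms by (intro mult_le_mono1) simp
  also have "\<dots> \<le> (l' * N + u') * N + v'" by (simp add: algebra_simps)
  finally show ?thesis by (simp add: address_def)
qed

text \<open>This starts the fill: from the boundary on, the table is 0 because the layer exceeds N,
  and the input is 0 because the matrix has ended.\<close>

lemma partial_table_end:
  assumes "pverts G = {..<N}" "0 < N"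
  shows "partial_table G N (address N (N + 1) 0 0) = matrix_input G"
proof
  fix a
  show "partial_table G N (address N (N + 1) 0 0) a = matrix_input G a"
  proof (cases "address N (N + 1) 0 0 \<le> a")
    case True
    then have le: "(N + 1) * N * N \<le> a - 1" and "a \<noteq> 0" by (auto simp: address_def)
    have "table G N a = 0"
    proof -
      have "(N + 1) * N * N div N div N \<le> (a - 1) div N div N"
        using le by (intro div_le_mono)
      with \<open>0 < N\<close> have "N < (a - 1) div N div N" by simp
      then show ?thesis by (simp add: table_def)
    qed
    moreover have "matrix_input G a = 0"
    proof -
      have "N * N \<le> (N + 1) * N * N" by simp
      with le \<open>a \<noteq> 0\<close> have "\<not> a \<le> N * N" by linarith
      then show ?thesis using \<open>a \<noteq> 0\<close> assms by (simp add: matrix_input_def)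
    qed
    ultimately show ?thesis by (simp add: partial_table_def)
  qed (simp add: partial_table_def)
qed

text \<open>Variable 0 is reserved for the multiplication by N.\<close>

definition cell :: "expr \<Rightarrow> expr \<Rightarrow> expr \<Rightarrow> expr" where
  "cell l u v = Plus (Num 1) (Plus (Sum 0 (Plus (Sum 0 l) u)) v)"

lemma eval_cell [simp]:
  assumes "x \<noteq> 0" "y \<noteq> 0"
  shows "eval N m e (cell (Plus (Var 1) (Num k)) (Var x) (Var y)) = address N (e 1 + k) (e x) (e y)"
    and "eval N m e (cell (Num 0) (Var x) (Var y)) = address N 0 (e x) (e y)"
  using assms by (simp_all add: cell_def address_def algebra_simps)

text \<open>The layer variable j runs over \<open>{..<N}\<close> and layer 0 is the matrix, so layer
  j + 1 is written from layers j + 2 and 0. The equality clause supplies distance 0.\<close>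

definition fill :: stmt where
  "fill =
     (let above = (\<lambda>u v. Read (cell (Plus (Var 1) (Num 2)) (Var u) (Var v)))
      in For 1 (For 2 (For 3 (Write (cell (Plus (Var 1) (Num 1)) (Var 2) (Var 3))
        (Neg (Neg (Plus (Equal (Var 2) (Var 3)) (Plus (above 2 3)
           (Exists 4 (Conj (above 2 4) (Read (cell (Num 0) (Var 4) (Var 3)))))))))))))"

lemma fold_rev_upt_invariant:
  assumes "I N s" "\<And>k s. k < N \<Longrightarrow> I (Suc k) s \<Longrightarrow> I k (f k s)"
  shows "I 0 (fold f (rev [0..<N]) s)"
  using assms by (induction N arbitrary: s) auto

definition dist_table :: "nat pair_pre_digraph \<Rightarrow> nat \<Rightarrow> nat \<Rightarrow> nat" where
  "dist_table G N = partial_table G N (address N 1 0 0)"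

text \<open>The three loops visit consecutive addresses in descending order, so a boundary moving
  down one cell at a time is the invariant of all of them.\<close>

lemma run_fill:
  assumes G: "fin_conn_graph G" "pverts G = {..<N}"
  shows "run N e fill (matrix_input G) = dist_table G N"
proof -
  define body where "body = Write (cell (Plus (Var 1) (Num 1)) (Var 2) (Var 3))
        (Neg (Neg (Plus (Equal (Var 2) (Var 3)) (Plus (Read (cell (Plus (Var 1) (Num 2)) (Var 2) (Var 3)))
           (Exists 4 (Conj (Read (cell (Plus (Var 1) (Num 2)) (Var 2) (Var 4)))
              (Read (cell (Num 0) (Var 4) (Var 3)))))))))"
  have body: "run N (e(1 := j, 2 := u, 3 := v)) body (partial_table G N (address N (j + 1) u (Suc v))) =
      partial_table G N (address N (j + 1) u v)" if "j < N" "u < N" "v < N" for j u v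
  proof -
    let ?m = "partial_table G N (address N (j + 1) u (Suc v))"
    let ?b = "u = v \<or> 0 < ?m (address N (j + 2) u v) \<or>
      (\<exists>w<N. 0 < ?m (address N (j + 2) u w) \<and> 0 < ?m (address N 0 w v))"
    have run: "run N (e(1 := j, 2 := u, 3 := v)) body ?m = ?m(address N (j + 1) u v := of_bool ?b)"
      by (simp add: body_def eval_Neg del: One_nat_def)
    have b: "?b \<longleftrightarrow> hop_dist G u v \<le> N - (j + 1)"
    proof -
      \<comment> \<open>Layer j + 2 lies on the finished side of the boundary and layer 0 on the
        other, so neither read depends on how far the present layer is filled.\<close>
      have up: "?m (address N (j + 2) u' v') = of_bool (j + 2 \<le> N \<and> hop_dist G u' v' \<le> N - (j + 2))"
        if "u' < N" "v' < N" for u' v'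
      proof -
        have "address N (j + 1) u (Suc v) \<le> address N (j + 2) u' v'"
          using address_less[of "j + 1" "j + 2" u N v u' v'] \<open>u < N\<close> \<open>v < N\<close>
          by (simp add: address_def)
        then show ?thesis using that by (simp add: partial_table_def table_address)
      qed
      have down: "?m (address N 0 w v) = of_bool ((w, v) \<in> parcs G)" if "w < N" for w
        using address_less[of 0 "j + 1" w N v u "Suc v"] that \<open>v < N\<close>
        by (simp add: partial_table_def matrix_input_address[OF G(2)])
      have V: "u \<in> pverts G" "v \<in> pverts G" using that by (simp_all add: G(2))
      have "?b \<longleftrightarrow> u = v \<or> j + 2 \<le> N \<and> (hop_dist G u v \<le> N - (j + 2) \<or>
          (\<exists>w<N. hop_dist G u w \<le> N - (j + 2) \<and> (w, v) \<in> parcs G))"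
      proof -
        have "(\<exists>w<N. 0 < ?m (address N (j + 2) u w) \<and> 0 < ?m (address N 0 w v)) \<longleftrightarrow>
            (\<exists>w<N. (j + 2 \<le> N \<and> hop_dist G u w \<le> N - (j + 2)) \<and> (w, v) \<in> parcs G)"
          by (intro ex_cong1 conj_cong refl) (simp_all only: up down that zero_less_of_bool_iff)
        then show ?thesis
          unfolding up[OF that(2,3)] zero_less_of_bool_iff by blast
      qed
      also have "\<dots> \<longleftrightarrow> hop_dist G u v \<le> N - (j + 1)"
      \<comment> \<open>In the first layer to be filled, j = N - 1, the layer above reads as zero
        and only \<open>u = v\<close> remains; in all others the recursion for distances
        applies.\<close>
      proof (cases "j + 2 \<le> N")
        case True
        then have "N - (j + 1) = Suc (N - (j + 2))" by simp
        then show ?thesis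
          using True hop_dist_le_Suc_iff[OF G(1) V, of "N - (j + 2)"] hop_dist_eq_0_iff[OF G(1) V]
          by (auto simp: G(2))
      next
        case False
        with that have "N - (j + 1) = 0" by simp
        with False show ?thesis using hop_dist_eq_0_iff[OF G(1) V] by simp
      qed
      finally show ?thesis .
    qed
    have table: "table G N (address N (j + 1) u v) = of_bool (hop_dist G u v \<le> N - (j + 1))"
      using that by (simp add: table_address)
    have Suc: "address N (j + 1) u (Suc v) = Suc (address N (j + 1) u v)"
      by (simp add: address_def)
    show ?thesis
      unfolding run b table[symmetric] unfolding Suc
      by (auto simp: partial_table_def fun_eq_iff not_less_eq_eq)
  qed
  have row: "run N (e(1 := j, 2 := u)) (For 3 body) (partial_table G N (address N (j + 1) (Suc u) 0)) =
      partial_table G N (address N (j + 1) u 0)" if "j < N" "u < N" for j u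
  proof -
    have "address N (j + 1) (Suc u) 0 = address N (j + 1) u N"
      by (simp add: address_def algebra_simps)
    then show ?thesis
      using fold_rev_upt_invariant[of "\<lambda>v m. m = partial_table G N (address N (j + 1) u v)" N _
          "\<lambda>v. run N (e(1 := j, 2 := u, 3 := v)) body"] body that by simp
  qed
  have layer: "run N (e(1 := j)) (For 2 (For 3 body)) (partial_table G N (address N (Suc j + 1) 0 0)) =
      partial_table G N (address N (j + 1) 0 0)" if "j < N" for j
  proof -
    have "address N (Suc j + 1) 0 0 = address N (j + 1) N 0"
      by (simp add: address_def algebra_simps)
    then show ?thesis
      using fold_rev_upt_invariant[of "\<lambda>u m. m = partial_table G N (address N (j + 1) u 0)" N _
          "\<lambda>u. run N (e(1 := j, 2 := u)) (For 3 body)"] row that by simp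
  qed
  have "0 < N"
    using G by (auto simp: fin_conn_graph_def connected_def strongly_connected_def)
  note table_end = partial_table_end[OF G(2) this]
  have "run N e (For 1 (For 2 (For 3 body))) (partial_table G N (address N (N + 1) 0 0)) =
      partial_table G N (address N 1 0 0)"
    using fold_rev_upt_invariant[of "\<lambda>j m. m = partial_table G N (address N (j + 1) 0 0)" N _
        "\<lambda>j. run N (e(1 := j)) (For 2 (For 3 body))"] layer by simp
  moreover have "fill = For 1 (For 2 (For 3 body))"
    by (simp add: fill_def body_def Let_def)
  ultimately show ?thesis by (simp only: table_end dist_table_def)
qed

text \<open>A distance d < N is the number of k < N with k < d; layer j + 1 tests
  \<open>d \<le> N - (j + 1)\<close>, so its zero entries are counted over all j.\<close>

definition dist_expr :: "nat \<Rightarrow> nat \<Rightarrow> expr" where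
  "dist_expr x y = Sum 1 (Neg (Read (cell (Plus (Var 1) (Num 1)) (Var x) (Var y))))"

lemma eval_dist_expr:
  assumes G: "fin_conn_graph G" "pverts G = {..<N}"
    and "2 \<le> x" "2 \<le> y" "e x < N" "e y < N"
  shows "eval N (dist_table G N) e (dist_expr x y) = hop_dist G (e x) (e y)"
proof -
  let ?d = "hop_dist G (e x) (e y)"
  have d: "?d < N"
    using relpow_hop_dist(2)[OF G(1)] assms(5,6) by (simp add: G(2))
  have "dist_table G N (address N (j + 1) (e x) (e y)) = of_bool (?d \<le> N - Suc j)"
    if "j < N" for j
  proof -
    have "address N 1 0 0 \<le> address N (j + 1) (e x) (e y)" by (simp add: address_def algebra_simps)
    then show ?thesis using assms that table_address[of "e x" N "e y" G "j + 1"]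
      by (simp add: dist_table_def partial_table_def)
  qed
  moreover have "eval N m e (dist_expr x y) = (\<Sum>j<N. of_bool (m (address N (j + 1) (e x) (e y)) = 0))" for m
    using assms(3,4) by (simp add: dist_expr_def eval_Neg del: One_nat_def)
  ultimately have "eval N (dist_table G N) e (dist_expr x y) =
      (\<Sum>j<N. of_bool (N - Suc j < ?d))"
    by (simp only:) (rule sum.cong, simp_all add: not_le)
  also have "\<dots> = (\<Sum>j<N. of_bool (j < ?d))"
    by (rule sum.nat_diff_reindex)
  also have "\<dots> = card {j. j < N \<and> j < ?d}"
    by (simp add: of_bool_def sum.If_cases lessThan_def Int_def)
  also have "{j. j < N \<and> j < ?d} = {..<?d}" using d by auto
  finally show ?thesis by simp
qed

section \<open>The Helly properties as expressions\<close>

definition conjs :: "expr list \<Rightarrow> expr" where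
  "conjs as = foldr Conj as (Num 1)"

definition All_less :: "nat list \<Rightarrow> expr \<Rightarrow> expr" where
  "All_less xs a = foldr (\<lambda>x b. Neg (Exists x (Neg b))) xs a"

lemma holds_conjs [simp]: "holds N m e (conjs as) \<longleftrightarrow> (\<forall>a\<in>set as. holds N m e a)"
  by (induction as) (simp_all add: conjs_def)

text \<open>\<open>override_on\<close> assigns all bound variables at once; distinctness keeps an
  inner quantifier from shadowing an outer one.\<close>

lemma holds_All_less:
  assumes "distinct xs"
  shows "holds N m e (All_less xs a) \<longleftrightarrow>
    (\<forall>f. (\<forall>x\<in>set xs. f x < N) \<longrightarrow> holds N m (override_on e f (set xs)) a)"
  using assms
proof (induction xs arbitrary: e)
  case Nil
  then show ?case by (simp add: All_less_def)
next
  case (Cons x xs)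
  have "holds N m e (All_less (x # xs) a) \<longleftrightarrow> (\<forall>k<N. holds N m (e(x := k)) (All_less xs a))"
    by (simp add: All_less_def)
  also have "\<dots> \<longleftrightarrow> (\<forall>k<N. \<forall>f. (\<forall>y\<in>set xs. f y < N) \<longrightarrow>
      holds N m (override_on (e(x := k)) f (set xs)) a)"
    using Cons by simp
  also have "\<dots> \<longleftrightarrow> (\<forall>f. (\<forall>y\<in>set (x # xs). f y < N) \<longrightarrow>
      holds N m (override_on e f (set (x # xs))) a)" (is "?L \<longleftrightarrow> ?R")
  proof
    assume ?L
    show ?R
    proof (intro allI impI)
      fix f assume f: "\<forall>y\<in>set (x # xs). f y < N"
      have "override_on e f (set (x # xs)) = override_on (e(x := f x)) f (set xs)"
        by (auto simp: override_on_def)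
      with \<open>?L\<close> f show "holds N m (override_on e f (set (x # xs))) a" by simp
    qed
  next
    assume ?R
    show ?L
    proof (intro allI impI)
      fix k f assume k: "k < N" and f: "\<forall>y\<in>set xs. f y < N"
      have "override_on (e(x := k)) f (set xs) = override_on e (f(x := k)) (set (x # xs))"
        using Cons.prems by (auto simp: override_on_def)
      moreover have "\<forall>y\<in>set (x # xs). (f(x := k)) y < N" using k f by simp
      ultimately show "holds N m (override_on (e(x := k)) f (set xs)) a"
        using \<open>?R\<close> by metis
    qed
  qed
  finally show ?case .
qed

text \<open>Variable 2 is never bound and denotes vertex 0, variable 3 is the common point, variable 4 a
  counter; the n centres and the n radii follow from variable 5 on.\<close>

definition common_point :: "nat \<Rightarrow> nat \<Rightarrow> expr \<Rightarrow> nat list \<Rightarrow> expr" where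
  "common_point n s member is = Exists 3 (Conj member (conjs (map (\<lambda>i.
     Leq (dist_expr (5 + i) 3) (Plus (Var (5 + n + i)) (Num s))) is)))"

text \<open>\<open>Plus\<close> with a negated premise is implication. The 2n outer quantifiers make
  the degree of the running time grow with n.\<close>

definition helly_expr :: "nat \<Rightarrow> nat \<Rightarrow> expr \<Rightarrow> nat list list \<Rightarrow> expr" where
  "helly_expr n s member subs = All_less [5..<5 + 2 * n]
     (Plus (Neg (conjs (map (common_point n s member) subs))) (common_point n s member [0..<n]))"

text \<open>Parity without division: half of a distance is below N, so it can be searched for by a
  bounded quantifier.\<close>

definition parity_expr :: "nat \<Rightarrow> expr" where
  "parity_expr b = Exists 4 (Equal (Plus (Plus (Var 4) (Var 4)) (Num b)) (dist_expr 2 3))"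

lemma holds_common_point:
  assumes G: "fin_conn_graph G" "pverts G = {..<N}"
    and member: "\<And>v. v < N \<Longrightarrow> holds N (dist_table G N) (e(3 := v)) member \<longleftrightarrow> v \<in> X"
    and e: "\<forall>i<n. e (5 + i) < N" and "set is \<subseteq> {..<n}"
  shows "holds N (dist_table G N) e (common_point n s member is) \<longleftrightarrow>
    (\<exists>v<N. v \<in> X \<and> (\<forall>i\<in>set is. hop_dist G (e (5 + i)) v \<le> e (5 + n + i) + s))"
proof -
  have "eval N (dist_table G N) (e(3 := v)) (dist_expr (5 + i) 3) =
      hop_dist G (e (5 + i)) v" if "v < N" "i \<in> set is" for i v
    using eval_dist_expr[OF G, of "5 + i" 3 "e(3 := v)"] that e assms(5) by auto
  then show ?thesis
    by (simp add: common_point_def member cong: conj_cong ball_cong)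
qed

lemma holds_parity_expr:
  assumes G: "fin_conn_graph G" "pverts G = {..<N}"
    and "e 2 = 0" "e 3 < N" "b < 2"
  shows "holds N (dist_table G N) e (parity_expr b) \<longleftrightarrow>
    hop_dist G 0 (e 3) mod 2 = b"
proof -
  let ?d = "hop_dist G 0 (e 3)"
  have "?d < N"
    using relpow_hop_dist(2)[OF G(1), of 0 "e 3"] assms(4) by (simp add: G(2))
  have "holds N (dist_table G N) e (parity_expr b) \<longleftrightarrow>
      (\<exists>x<N. x + x + b = ?d)"
    using eval_dist_expr[OF G, of 2 3 "e(4 := _)"] assms by (simp add: parity_expr_def)
  also have "\<dots> \<longleftrightarrow> ?d mod 2 = b"
  proof
    assume "\<exists>x<N. x + x + b = ?d"
    then obtain x where "x + x + b = ?d" by blast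
    then have "?d = b + x * 2" by simp
    then show "?d mod 2 = b" using \<open>b < 2\<close> by simp
  next
    assume "?d mod 2 = b"
    then have "?d div 2 + ?d div 2 + b = ?d" by presburger
    moreover have "?d div 2 < N" using \<open>?d < N\<close> by simp
    ultimately show "\<exists>x<N. x + x + b = ?d" by blast
  qed
  finally show ?thesis .
qed

lemma holds_helly_expr:
  assumes G: "fin_conn_graph G" "pverts G = {..<N}"
    and member: "\<And>e v. e 2 = 0 \<Longrightarrow> v < N \<Longrightarrow>
      holds N (dist_table G N) (e(3 := v)) member \<longleftrightarrow> v \<in> X"
    and subs: "set ` set subs = {S. S \<subseteq> {..<n} \<and> card S = m}"
  shows "holds N (dist_table G N) (\<lambda>_. 0) (helly_expr n s member subs) \<longleftrightarrow>
    bounded_helly G N n m s X"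
proof -
  let ?m = "dist_table G N"
  let ?xs = "[5..<5 + 2 * n]"
  define common where "common c \<rho> S \<longleftrightarrow> (\<exists>v<N. v \<in> X \<and> (\<forall>i\<in>S. hop_dist G (c i) v \<le> \<rho> i + s))"
    for c \<rho> and S :: "nat set"
  define helly_at where "helly_at c \<rho> \<longleftrightarrow>
    ((\<forall>S\<subseteq>{..<n}. card S = m \<longrightarrow> common c \<rho> S) \<longrightarrow> common c \<rho> {..<n})" for c \<rho>
  have body: "holds N ?m (override_on (\<lambda>_. 0) f (set ?xs))
      (Plus (Neg (conjs (map (common_point n s member) subs))) (common_point n s member [0..<n])) \<longleftrightarrow>
      helly_at (\<lambda>i. f (5 + i)) (\<lambda>i. f (5 + n + i))"
    if f: "\<forall>x\<in>set ?xs. f x < N" for f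
  proof -
    let ?e = "override_on (\<lambda>_. 0) f (set ?xs)"
    have e: "?e (5 + i) = f (5 + i)" "?e (5 + n + i) = f (5 + n + i)" if "i < n" for i
      using that by (simp_all add: override_on_def)
    have "?e 2 = 0" by (simp add: override_on_def)
    have "\<forall>i<n. ?e (5 + i) < N" using e(1) f by simp
    have point: "holds N ?m ?e (common_point n s member is) \<longleftrightarrow>
        common (\<lambda>i. f (5 + i)) (\<lambda>i. f (5 + n + i)) (set is)" if "set is \<subseteq> {..<n}" for "is"
    proof -
      have "(\<forall>i\<in>set is. hop_dist G (?e (5 + i)) v \<le> ?e (5 + n + i) + s) \<longleftrightarrow>
          (\<forall>i\<in>set is. hop_dist G (f (5 + i)) v \<le> f (5 + n + i) + s)" for v
      proof (intro ball_cong refl)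
        fix i assume "i \<in> set is"
        with that have "i < n" by blast
        from e[OF this]
        show "hop_dist G (?e (5 + i)) v \<le> ?e (5 + n + i) + s \<longleftrightarrow>
            hop_dist G (f (5 + i)) v \<le> f (5 + n + i) + s"
          by (simp only:)
      qed
      then show ?thesis
        using holds_common_point[OF G member[of ?e, OF \<open>?e 2 = 0\<close>] \<open>\<forall>i<n. ?e (5 + i) < N\<close> that, where s = s]
        unfolding common_def by (simp only:)
    qed
    have "(\<forall>is\<in>set subs. holds N ?m ?e (common_point n s member is)) \<longleftrightarrow>
        (\<forall>is\<in>set subs. common (\<lambda>i. f (5 + i)) (\<lambda>i. f (5 + n + i)) (set is))"
      proof (intro ball_cong refl point)
      fix "is" assume "is \<in> set subs"
      then have "set is \<in> set ` set subs" by (rule imageI)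
      then show "set is \<subseteq> {..<n}" unfolding subs by simp
    qed
    also have "\<dots> \<longleftrightarrow> (\<forall>S\<in>set ` set subs. common (\<lambda>i. f (5 + i)) (\<lambda>i. f (5 + n + i)) S)"
      by blast
    also have "\<dots> \<longleftrightarrow> (\<forall>S\<subseteq>{..<n}. card S = m \<longrightarrow> common (\<lambda>i. f (5 + i)) (\<lambda>i. f (5 + n + i)) S)"
      unfolding subs by blast
    finally have "(\<forall>is\<in>set subs. holds N ?m ?e (common_point n s member is)) \<longleftrightarrow>
        (\<forall>S\<subseteq>{..<n}. card S = m \<longrightarrow> common (\<lambda>i. f (5 + i)) (\<lambda>i. f (5 + n + i)) S)" .
    moreover have "holds N ?m ?e (common_point n s member [0..<n]) \<longleftrightarrow>
        common (\<lambda>i. f (5 + i)) (\<lambda>i. f (5 + n + i)) {..<n}"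
      using point[of "[0..<n]"] by (simp add: atLeast0LessThan)
    moreover have "holds N ?m ?e
        (Plus (Neg (conjs (map (common_point n s member) subs))) (common_point n s member [0..<n])) \<longleftrightarrow>
        ((\<forall>is\<in>set subs. holds N ?m ?e (common_point n s member is)) \<longrightarrow>
          holds N ?m ?e (common_point n s member [0..<n]))"
      by auto
    ultimately show ?thesis unfolding helly_at_def by (simp only:)
  qed
  have "holds N ?m (\<lambda>_. 0) (helly_expr n s member subs) \<longleftrightarrow>
      (\<forall>f. (\<forall>x\<in>set ?xs. f x < N) \<longrightarrow> helly_at (\<lambda>i. f (5 + i)) (\<lambda>i. f (5 + n + i)))"
    unfolding helly_expr_def holds_All_less[OF distinct_upt] by (intro all_cong1 imp_cong refl body)
  also have "\<dots> \<longleftrightarrow> (\<forall>c \<rho>. (\<forall>i<n. c i < N \<and> \<rho> i < N) \<longrightarrow> helly_at c \<rho>)" (is "?L \<longleftrightarrow> ?R")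
  proof
    assume ?L
    show ?R
    proof (intro allI impI)
      fix c \<rho> :: "nat \<Rightarrow> nat"
      assume c\<rho>: "\<forall>i<n. c i < N \<and> \<rho> i < N"
      define f where "f x = (if x < 5 + n then c (x - 5) else \<rho> (x - (5 + n)))" for x
      have "\<forall>x\<in>set ?xs. f x < N" using c\<rho> by (auto simp: f_def)
      with \<open>?L\<close> have "helly_at (\<lambda>i. f (5 + i)) (\<lambda>i. f (5 + n + i))" by blast
      \<comment> \<open>\<open>f (5 + i)\<close> is guaranteed to be \<open>c i\<close> only for i <
        n; hence the restriction to index sets below n.\<close>
      moreover have "common (\<lambda>i. f (5 + i)) (\<lambda>i. f (5 + n + i)) S \<longleftrightarrow> common c \<rho> S" if "S \<subseteq> {..<n}" for S
      proof -
        have "f (5 + i) = c i" "f (5 + n + i) = \<rho> i" if "i \<in> S" for i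
          using that \<open>S \<subseteq> {..<n}\<close> by (auto simp: f_def)
        then show ?thesis unfolding common_def by (simp cong: ball_cong)
      qed
      ultimately show "helly_at c \<rho>" unfolding helly_at_def by blast
    qed
  next
    assume R: ?R
    show ?L
    proof (intro allI impI)
      fix f :: "nat \<Rightarrow> nat"
      assume "\<forall>x\<in>set ?xs. f x < N"
      then have "\<forall>i<n. f (5 + i) < N \<and> f (5 + n + i) < N" by simp
      then show "helly_at (\<lambda>i. f (5 + i)) (\<lambda>i. f (5 + n + i))"
        by (rule R[THEN spec, THEN spec, THEN mp])
    qed
  qed
  also have "\<dots> \<longleftrightarrow> bounded_helly G N n m s X"
    unfolding bounded_helly_def helly_at_def common_def by (simp only: Ball_def lessThan_iff)
  finally show ?thesis .
qed

theorem proposition5p1: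
  fixes n m :: nat
  assumes "0 < m" and "m < n"
  shows "(\<exists>P. decides_in_poly_time P fin_conn_graph (helly n m)) \<and>
         (\<exists>P. decides_in_poly_time P (\<lambda>G. fin_conn_graph G \<and> bipartite G) (bipartite_helly n m))"
proof
  let ?subsets = "{S. S \<subseteq> {..<n} \<and> card S = m}"
  have "finite ?subsets"
    by (rule finite_subset[of _ "Pow {..<n}"]) auto
  then obtain Ss where Ss: "set Ss = ?subsets"
    using finite_list by metis
  \<comment> \<open>Expressions are finite syntax, so each subset has to be presented by a
    list.\<close>
  have "set (sorted_list_of_set S) = S" if "S \<in> ?subsets" for S
    using that finite_subset[of S "{..<n}"] by simp
  then have "(\<lambda>S. set (sorted_list_of_set S)) ` ?subsets = (\<lambda>S. S) ` ?subsets"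
    by (rule image_cong[OF refl])
  then have "set ` set (map sorted_list_of_set Ss) = ?subsets"
    unfolding set_map image_image Ss image_ident .
  then obtain subs where subs: "set ` set subs = ?subsets" ..
  show "\<exists>P. decides_in_poly_time P fin_conn_graph (helly n m)"
  proof (rule decides_in_poly_timeI)
    fix G and N :: nat
    assume G: "fin_conn_graph G" "pverts G = {..<N}"
    \<comment> \<open>The answer must be exactly 0 or 1, hence the double negation. Radii start at 1
      and any vertex may be the common point, hence offset 1 and the constantly true membership
      test.\<close>
    show "eval N (run N (\<lambda>_. 0) fill (matrix_input G)) (\<lambda>_. 0)
        (Neg (Neg (helly_expr n 1 (Num 1) subs))) = of_bool (helly n m G)"
    proof -
      have "holds N (dist_table G N) (\<lambda>_. 0) (helly_expr n 1 (Num 1) subs) \<longleftrightarrow> helly n m G"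
        unfolding helly_iff_bounded_helly[OF G assms] by (rule holds_helly_expr[OF G _ subs]) simp
      then show ?thesis by (simp add: run_fill[OF G] eval_Neg)
    qed
  qed
  show "\<exists>P. decides_in_poly_time P (\<lambda>G. fin_conn_graph G \<and> bipartite G) (bipartite_helly n m)"
  proof (rule decides_in_poly_timeI)
    fix G and N :: nat
    assume "fin_conn_graph G \<and> bipartite G" and G2: "pverts G = {..<N}"
    then have G: "fin_conn_graph G" "pverts G = {..<N}" and "bipartite G" by auto
    \<comment> \<open>Radii may be 0 here, hence offset 0. As G is promised to be bipartite, the two
      parity classes of vertex 0 are its partite classes, and both are tested.\<close>
    have "holds N (dist_table G N) (\<lambda>_. 0)
        (helly_expr n 0 (parity_expr b) subs) \<longleftrightarrow>
        bounded_helly G N n m 0 {v. hop_dist G 0 v mod 2 = b}" if "b < 2" for b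
      by (rule holds_helly_expr[OF G _ subs]) (simp add: holds_parity_expr[OF G] that)
    from this[of 0] this[of 1] show "eval N (run N (\<lambda>_. 0) fill (matrix_input G)) (\<lambda>_. 0)
        (Neg (Neg (Conj (helly_expr n 0 (parity_expr 0) subs) (helly_expr n 0 (parity_expr 1) subs)))) =
        of_bool (bipartite_helly n m G)"
      unfolding run_fill[OF G] eval_Neg holds_simps
        bipartite_helly_iff_bounded_helly[OF G(1) \<open>bipartite G\<close> G(2) assms]
      by simp
  qed
qed

end
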